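(* For $p\in\mathbb{N}_0$ and all $n\in\mathbb{N}$, \begin{align*} \sum_{m=1}^nm^pH_{m-1}^3=&H_n(-p)H_n^3-3\Big(C^{(p)}_0(n)+\frac{B_p}{2}\Big)H_n^2+\frac{B_p}{2}H_n(2)\\ &+\Big(6C^{(p)}_{0,0}(n)+3D^{(p)}(B)-3C^{(p)}_1(n)-\frac p2B_{p-1}\Big)H_n\\ &-6C^{(p)}_{0,0,0}(n)+3C^{(p)}_{0,1}(n)+3C^{(p)}_{1,1}(n)-C^{(p)}_2(n). \end{align*}
   Context: $H_m(k)=\sum_{j=1}^mj^{-k}$, $H_m=H_m(1)$ (empty sums $=0$), and $H_n(-p)=\sum_{m=1}^nm^p$. Bernoulli numbers: $\frac{te^t}{e^t-1}=\sum_{j\ge0}B_j\frac{t^j}{j!}$; the term $\frac p2B_{p-1}$ is $0$ when $p=0$. For $p\in\mathbb{N}_0$, $r\ge1$, $a_2,\dots,a_r\in\mathbb{N}_0$ and $a_1=0$, $$C^{(p)}_{a_2,\dots,a_r}(x)=\sum_{\substack{j_1,\dots,j_r\ge0\\ j_1+\dots+j_r\le p-a_r}}\Big(\prod_{i=1}^r\frac{\binom{p+1-a_i-j_1-\dots-j_{i-1}}{j_i}B_{j_i}}{p+1-a_i-j_1-\dots-j_{i-1}}\Big)x^{p+1-a_r-j_1-\dots-j_r}$$ (empty sum $=0$); for $r=1$ this is $C^{(p)}(x)=\sum_{j=0}^p\binom{p+1}{j}\frac{B_j}{p+1}x^{p+1-j}$. $D^{(p)}(x):=C^{(p)}(x)/x$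 (a polynomial), and $D^{(p)}(B)$ is obtained by replacing each $x^i$ in $D^{(p)}(x)$ by $B_i$. *)

theory Defs
  imports
    "HOL-Analysis.Harmonic_Numbers"
    "HOL-Computational_Algebra.Computational_Algebra"
begin

text \<open>The exponent is an integer: \<^term>\<open>gen_harm n (- int p)\<close> is the power sum
  \<open>1 ^ p + \<dots> + n ^ p\<close>.\<close>

definition gen_harm :: "nat \<Rightarrow> int \<Rightarrow> real" where
  "gen_harm m k = (\<Sum>j=1..m. real j powi (- k))"

text \<open>Bernoulli numbers with the convention \<open>B\<^sub>1 = 1/2\<close>, read off from the exponential
  generating function \<open>t e^t / (e^t - 1)\<close>. Division of formal power series cancels the common
  factor \<open>t\<close> of numerator and denominator.\<close>

definition bernoulli_egf :: "real fps" where
  "bernoulli_egf = fps_X * fps_exp 1 / (fps_exp 1 - 1)"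

definition bern :: "nat \<Rightarrow> real" where
  "bern j = fact j * fps_nth bernoulli_egf j"

text \<open>The list \<open>as\<close> holds \<open>a\<^sub>2, \<dots>, a\<^sub>r\<close>; prepending \<open>a\<^sub>1 = 0\<close> gives \<open>a\<close>, whose entries
  (and those of \<open>js\<close>) are indexed from 0, so that \<open>sum_list (take i js)\<close> is the sum of the
  \<open>j\<close>'s preceding position \<open>i\<close>. The condition \<open>j\<^sub>1 + \<dots> + j\<^sub>r \<le> p - a\<^sub>r\<close> is written without
  subtraction, so that the sum is empty when \<open>p < a\<^sub>r\<close>; it makes the exponent positive.\<close>

definition C_index :: "nat \<Rightarrow> nat list \<Rightarrow> nat list set" where
  "C_index p a = {js. length js = length a \<and> sum_list js + last a \<le> p}"

definition C_coeff :: "nat \<Rightarrow> nat list \<Rightarrow> nat list \<Rightarrow> real" where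
  "C_coeff p a js =
     (\<Prod>i<length a.
        let q = real p + 1 - real (a ! i) - real (sum_list (take i js))
        in (q gchoose (js ! i)) * bern (js ! i) / q)"

definition C_poly :: "nat \<Rightarrow> nat list \<Rightarrow> real poly" where
  "C_poly p as =
     (let a = 0 # as
      in \<Sum>js\<in>C_index p a. monom (C_coeff p a js) (p + 1 - last a - sum_list js))"

text \<open>\<open>C_poly p []\<close> has no constant term, so this division is exact.\<close>

definition D_poly :: "nat \<Rightarrow> real poly" where
  "D_poly p = C_poly p [] div [:0, 1:]"

text \<open>Umbral evaluation: replaces each \<open>x ^ i\<close> by \<open>B\<^sub>i\<close>.\<close>

definition umbral :: "real poly \<Rightarrow> real" where
  "umbral f = (\<Sum>i\<le>degree f. coeff f i * bern i)"

lemma gen_harm_one: "gen_harm n 1 = harm n"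
  by (simp add: gen_harm_def harm_def power_int_minus)

lemma gen_harm_neg: "gen_harm n (- int p) = (\<Sum>m=1..n. real m ^ p)"
  by (simp add: gen_harm_def)

lemma finite_C_index: "finite (C_index p a)"
proof (rule finite_subset)
  show "C_index p a \<subseteq> {js. set js \<subseteq> {..p} \<and> length js = length a}"
    by (auto simp: C_index_def dest: member_le_sum_list)
  show "finite {js. set js \<subseteq> {..p} \<and> length js = length a}"
    by (rule finite_lists_length_eq) simp
qed

lemma bernoulli_egf_mult: "bernoulli_egf * (fps_exp 1 - 1) = fps_X * fps_exp 1"
proof -
  have nz: "fps_exp 1 - 1 \<noteq> (0 :: real fps)"
  proof
    assume "fps_exp 1 - 1 = (0 :: real fps)"
    then have "fps_nth (fps_exp 1 - 1 :: real fps) 1 = 0" by simp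
    then show False by simp
  qed
  have "fps_exp 1 - 1 dvd (fps_X * fps_exp 1 :: real fps)"
  proof -
    have "subdegree (fps_exp 1 - 1 :: real fps) = 1"
      by (rule subdegreeI) auto
    moreover have "subdegree (fps_X * fps_exp 1 :: real fps) = 1"
      by (rule subdegreeI) auto
    ultimately show ?thesis
      using nz by (subst fps_dvd_iff) (auto simp: fps_eq_iff)
  qed
  then show ?thesis
    by (simp add: bernoulli_egf_def)
qed

lemma poly_C_poly_Nil:
  "poly (C_poly p []) x = (\<Sum>j=0..p.
    real ((p + 1) choose j) * bern j / real (p + 1) * x ^ (p + 1 - j))"
proof -
  have eq: "C_index p [0] = (\<lambda>j. [j]) ` {0..p}"
    by (auto simp: C_index_def length_Suc_conv)
  have "inj_on (\<lambda>j. [j]) {0..p}"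
    by (auto simp: inj_on_def)
  then have "poly (C_poly p []) x =
      (\<Sum>j=0..p. ((real p + 1) gchoose j) * bern j / (real p + 1) * x ^ (p + 1 - j))"
    by (simp add: C_poly_def eq sum.reindex poly_sum poly_monom C_coeff_def Let_def)
  also have "real p + 1 = real (p + 1)"
    by simp
  finally show ?thesis
    by (simp only: binomial_gbinomial)
qed

lemma D_poly_mult: "[:0, 1:] * D_poly p = C_poly p []"
proof -
  have "poly (C_poly p []) 0 = 0"
    unfolding poly_C_poly_Nil by (intro sum.neutral) (auto simp: zero_power)
  then have "[:0, 1:] dvd C_poly p []"
    by (simp add: poly_eq_0_iff_dvd)
  then show ?thesis
    unfolding D_poly_def by (rule dvd_mult_div_cancel)
qed

end

theory Submission
  imports Defs
begin

text \<open>
  Appending an entry \<open>b = a\<^sub>r + e\<close> to the index list acts on the polynomial \<open>C\<close> as follows: drop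
  the terms of degree at most \<open>e\<close>, divide by \<open>x ^ (e + 1)\<close>, and sum the resulting polynomial over
  \<open>1, \<dots>, n\<close> by Faulhaber's formula. Hence all polynomials in the theorem satisfy simple recurrences
  in \<open>n\<close>, whose only correction terms come from the coefficients of \<open>x\<close> and \<open>x\<^sup>2\<close> (namely
  \<open>B\<^sub>p\<close>, \<open>p/2 B\<^sub>p\<^sub>-\<^sub>1\<close> and, after one summation, \<open>D(B)\<close>). The identity then follows by
  induction on \<open>n\<close>; this is summation by parts applied repeatedly.
\<close>

section \<open>Faulhaber's formula from generating functions\<close>

lemma bernoulli_egf_mult_exp:
  "bernoulli_egf * (fps_exp (real n) - 1) = fps_X * (\<Sum>m=1..n. fps_exp (real m))"
proof -
  \<comment> \<open>The telescoping geometric sum in powers of \<open>fps_exp 1\<close>. Its factor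
    \<open>fps_exp 1 - 1\<close> also meets the denominator of \<open>bernoulli_egf\<close> and is
    cancelled at the end.\<close>
  have geom: "(fps_exp 1 - 1) * (\<Sum>m=1..n. fps_exp (real m)) = fps_exp 1 * (fps_exp (real n) - 1)"
  proof (induction n)
    case (Suc n)
    have "fps_exp (real (Suc n)) = fps_exp 1 * fps_exp (real n)"
      by (metis fps_exp_add_mult of_nat_Suc)
    then show ?case
      using Suc.IH by (simp add: algebra_simps)
  qed simp
  have nz: "fps_exp 1 - 1 \<noteq> (0 :: real fps)"
    using fps_exp_eq_iff[of "1::real" 0] by simp
  have "(fps_exp 1 - 1) * (bernoulli_egf * (fps_exp (real n) - 1)) =
      (bernoulli_egf * (fps_exp 1 - 1)) * (fps_exp (real n) - 1)"
    by (simp only: ac_simps)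
  also have "\<dots> = fps_X * ((fps_exp 1 - 1) * (\<Sum>m=1..n. fps_exp (real m)))"
    by (simp only: bernoulli_egf_mult geom ac_simps)
  also have "\<dots> = (fps_exp 1 - 1) * (fps_X * (\<Sum>m=1..n. fps_exp (real m)))"
    by (simp only: ac_simps)
  finally show ?thesis
    using nz by (metis mult_left_cancel)
qed

text \<open>Compare coefficients of degree \<open>p + 1\<close> in the preceding identity, scaled by
  \<open>fact p\<close>. The convolution stops at \<open>j = p\<close> because
  \<open>fps_exp (real n) - 1\<close> has no constant term.\<close>

lemma faulhaber: "poly (C_poly p []) (real n) = (\<Sum>m=1..n. real m ^ p)"
proof -
  have "poly (C_poly p []) (real n) =
      (\<Sum>j=0..p. fact p * (fps_nth bernoulli_egf j * (real n ^ (p + 1 - j) / fact (p + 1 - j))))"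
    unfolding poly_C_poly_Nil
  proof (rule sum.cong)
    fix j assume "j \<in> {0..p}"
    then have "real ((p + 1) choose j) = fact (p + 1) / (fact j * fact (p + 1 - j))"
      by (intro binomial_fact) simp
    then show "real ((p + 1) choose j) * bern j / real (p + 1) * real n ^ (p + 1 - j) =
        fact p * (fps_nth bernoulli_egf j * (real n ^ (p + 1 - j) / fact (p + 1 - j)))"
      by (simp add: bern_def divide_simps del: of_nat_Suc)
  qed simp
  also have "\<dots> = fact p * fps_nth (bernoulli_egf * (fps_exp (real n) - 1)) (p + 1)"
    by (simp add: fps_mult_nth sum_distrib_left)
  also have "\<dots> = (\<Sum>m=1..n. real m ^ p)"
    unfolding bernoulli_egf_mult_exp by (simp add: fps_sum_nth sum_distrib_left)
  finally show ?thesis .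
qed

section \<open>Low-order coefficients\<close>

lemma C_poly_Nil:
  "C_poly p [] = (\<Sum>j\<le>p. monom (((real p + 1) gchoose j) * bern j / (real p + 1)) (p + 1 - j))"
proof -
  have eq: "C_index p [0] = (\<lambda>j. [j]) ` {..p}"
    by (auto simp: C_index_def length_Suc_conv)
  have "inj_on (\<lambda>j. [j]) {..p}"
    by (auto simp: inj_on_def)
  then show ?thesis
    by (simp add: C_poly_def eq sum.reindex C_coeff_def Let_def)
qed

lemma coeff_C_poly_Nil:
  "i < p + 1 \<Longrightarrow>
    coeff (C_poly p []) (i + 1) = real ((p + 1) choose (p - i)) * bern (p - i) / real (p + 1)"
proof -
  assume i: "i < p + 1"
  have "coeff (C_poly p []) (i + 1) =
      (\<Sum>j\<le>p. if j = p - i then ((real p + 1) gchoose j) * bern j / (real p + 1) else 0)"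
    unfolding C_poly_Nil coeff_sum using i by (intro sum.cong) auto
  also have "\<dots> = ((real p + 1) gchoose (p - i)) * bern (p - i) / (real p + 1)"
    by simp
  also have "real p + 1 = real (p + 1)"
    by simp
  finally show ?thesis
    by (simp only: binomial_gbinomial)
qed

lemma coeff_C_poly_Nil_1: "coeff (C_poly p []) 1 = bern p"
  using coeff_C_poly_Nil[of 0 p] by (simp del: of_nat_Suc)

text \<open>Degree 2 belongs to \<open>j = p - 1\<close>, where the binomial divided by
  \<open>p + 1\<close> is \<open>p / 2\<close>. For \<open>p = 0\<close> only a linear term
  exists.\<close>

lemma coeff_C_poly_Nil_2:
  "coeff (C_poly p []) 2 = (if p = 0 then 0 else real p / 2 * bern (p - 1))"
proof (cases p)
  case 0
  then show ?thesis by (simp add: C_poly_Nil)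
next
  case (Suc k)
  have "fact (Suc (Suc k)) = real (Suc (Suc k)) * real (Suc k) * fact k" "fact (Suc (Suc 0)) = (2::real)"
    by simp_all
  then have choose: "real (Suc (Suc k) choose k) = real (Suc (Suc k)) * (real (Suc k) / 2)"
    using binomial_fact[of k "Suc (Suc k)", where 'a = real]
    by (simp add: Suc_diff_le del: of_nat_Suc fact_Suc binomial_Suc_Suc)
  have "coeff (C_poly p []) 2 = real (Suc (Suc k) choose k) * bern k / real (Suc (Suc k))"
    using coeff_C_poly_Nil[of 1 p] Suc
    by (simp del: of_nat_Suc binomial_Suc_Suc add: numeral_2_eq_2)
  also have "\<dots> = real (Suc k) / 2 * bern k"
    unfolding choose by (simp del: of_nat_Suc)
  finally show ?thesis
    by (simp add: Suc)
qed

text \<open>The bound in \<open>C_index\<close> keeps every exponent positive. So dividing by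
  \<open>x\<close> once needs no correction term.\<close>

lemma coeff_C_poly_0: "coeff (C_poly p as) 0 = 0"
  unfolding C_poly_def Let_def coeff_sum
  by (intro sum.neutral) (auto simp: C_index_def)

section \<open>Appending an entry to the index list\<close>

lemma smult_sum_right: "smult c (sum f A) = (\<Sum>i\<in>A. smult c (f i))"
  by (induction A rule: infinite_finite_induct) (simp_all add: smult_add_right)

text \<open>Split off the last summation index: with the others fixed, its factors and powers of
  \<open>x\<close> add up to a one-index polynomial of lower order. The hypothesis makes every
  prefix of an admissible index list admissible.\<close>

lemma C_poly_snoc:
  assumes "last (0 # as) \<le> b"
  shows "C_poly p (as @ [b]) =
    (\<Sum>js | js \<in> C_index p (0 # as) \<and> sum_list js + b \<le> p.
      smult (C_coeff p (0 # as) js) (C_poly (p - b - sum_list js) []))"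
proof -
  let ?A = "{js. js \<in> C_index p (0 # as) \<and> sum_list js + b \<le> p}"
  let ?f = "\<lambda>(js, j). js @ [j]"
  let ?S = "SIGMA js:?A. {..p - b - sum_list js}"
  have idx: "C_index p (0 # as @ [b]) = ?f ` ?S"
  proof (intro equalityI subsetI)
    fix l assume l: "l \<in> C_index p (0 # as @ [b])"
    then have "l \<noteq> []" by (auto simp: C_index_def)
    then obtain js j where "l = js @ [j]" by (metis append_butlast_last_id)
    with l assms show "l \<in> ?f ` ?S"
      by (force simp: C_index_def)
  next
    fix l assume "l \<in> ?f ` ?S"
    then show "l \<in> C_index p (0 # as @ [b])"
      by (auto simp: C_index_def)
  qed
  have inj: "inj_on ?f ?S"
    by (auto simp: inj_on_def)
  have fin: "finite ?A"
    by (rule finite_subset[OF _ finite_C_index]) auto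
  have "C_poly p (as @ [b]) =
      (\<Sum>(js, j)\<in>?S. monom (C_coeff p (0 # as @ [b]) (js @ [j])) (p + 1 - b - sum_list (js @ [j])))"
    unfolding C_poly_def Let_def idx sum.reindex[OF inj] by (simp add: case_prod_unfold)
  also have "\<dots> = (\<Sum>js\<in>?A. \<Sum>j\<le>p - b - sum_list js.
      monom (C_coeff p (0 # as @ [b]) (js @ [j])) (p + 1 - b - sum_list (js @ [j])))"
    by (rule sum.Sigma[symmetric]) (use fin in auto)
  also have "\<dots> = (\<Sum>js\<in>?A. smult (C_coeff p (0 # as) js) (C_poly (p - b - sum_list js) []))"
  proof (rule sum.cong)
    fix js assume js: "js \<in> ?A"
    then have len: "length js = Suc (length as)" and le: "sum_list js + b \<le> p"
      by (auto simp: C_index_def)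
    \<comment> \<open>\<open>k + 1\<close> is the denominator \<open>q\<close> of the last factor;
      by \<open>le\<close> the truncated subtraction is exact.\<close>
    define k where "k = p - b - sum_list js"
    have q: "real p + 1 - real b - real (sum_list js) = real k + 1"
      using le by (simp add: k_def)
    have "C_coeff p (0 # as @ [b]) (js @ [j]) =
        C_coeff p (0 # as) js * (((real k + 1) gchoose j) * bern j / (real k + 1))" for j
    proof -
      have nth: "(0 # as @ [b]) ! i = (if i < Suc (length as) then (0 # as) ! i else b)"
        if "i < Suc (Suc (length as))" for i
        using that nth_append[of "0 # as" "[b]" i] by (auto simp: less_Suc_eq)
      have "C_coeff p (0 # as @ [b]) (js @ [j]) = C_coeff p (0 # as) js *
          (let q = real p + 1 - real b - real (sum_list js) in (q gchoose j) * bern j / q)"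
        unfolding C_coeff_def length_Cons length_append_singleton prod.lessThan_Suc[of _ "Suc (length as)"]
        using len by (intro arg_cong2[of _ _ _ _ "(*)"] prod.cong) (simp_all add: nth nth_append)
      then show ?thesis
        by (simp only: Let_def q)
    qed
    moreover have "p + 1 - b - sum_list (js @ [j]) = k + 1 - j" for j
      using le by (auto simp: k_def)
    ultimately show "(\<Sum>j\<le>p - b - sum_list js.
        monom (C_coeff p (0 # as @ [b]) (js @ [j])) (p + 1 - b - sum_list (js @ [j]))) =
        smult (C_coeff p (0 # as) js) (C_poly (p - b - sum_list js) [])"
      unfolding k_def[symmetric]
      by (simp only: C_poly_Nil smult_sum_right smult_monom)
  qed simp
  finally show ?thesis .
qed

text \<open>The monomials of degree above \<open>e\<close> are those with
  \<open>sum_list js + (last (0 # as) + e) \<le> p\<close>. This is the range of summation in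
  \<open>C_poly_snoc\<close>, and the quotient exponents are the orders occurring there.\<close>

lemma poly_minus_low_coeffs_div:
  fixes x :: real
  assumes "x \<noteq> 0"
  shows "(poly (C_poly p as) x - (\<Sum>k\<le>e. coeff (C_poly p as) k * x ^ k)) / x ^ (e + 1) =
    (\<Sum>js | js \<in> C_index p (0 # as) \<and> sum_list js + (last (0 # as) + e) \<le> p.
      C_coeff p (0 # as) js * x ^ (p - (last (0 # as) + e) - sum_list js))"
proof -
  let ?I = "C_index p (0 # as)" and ?c = "C_coeff p (0 # as)"
  let ?d = "\<lambda>js. p + 1 - last (0 # as) - sum_list js"
  have "(\<Sum>k\<le>e. coeff (C_poly p as) k * x ^ k) =
      (\<Sum>k\<le>e. \<Sum>js\<in>?I. if k = ?d js then ?c js * x ^ k else 0)"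
    unfolding C_poly_def Let_def coeff_sum sum_distrib_right
    by (intro sum.cong) auto
  \<comment> \<open>After the swap, each \<open>js\<close> contributes at most at the single
    \<open>k = ?d js\<close>.\<close>
  also have "\<dots> = (\<Sum>js\<in>?I. if ?d js \<le> e then ?c js * x ^ ?d js else 0)"
    by (subst sum.swap) (simp cong: if_cong)
  finally have low: "(\<Sum>k\<le>e. coeff (C_poly p as) k * x ^ k) =
    (\<Sum>js\<in>?I. if ?d js \<le> e then ?c js * x ^ ?d js else 0)" .
  have "poly (C_poly p as) x = (\<Sum>js\<in>?I. ?c js * x ^ ?d js)"
    by (simp add: C_poly_def Let_def poly_sum poly_monom)
  then have "poly (C_poly p as) x - (\<Sum>k\<le>e. coeff (C_poly p as) k * x ^ k) =
      (\<Sum>js\<in>?I. if ?d js \<le> e then 0 else ?c js * x ^ ?d js)"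
    unfolding low by (simp only: flip: sum_subtractf) (intro sum.cong, auto)
  then have "(poly (C_poly p as) x - (\<Sum>k\<le>e. coeff (C_poly p as) k * x ^ k)) / x ^ (e + 1) =
      (\<Sum>js\<in>?I. (if ?d js \<le> e then 0 else ?c js * x ^ ?d js) / x ^ (e + 1))"
    by (simp only: sum_divide_distrib)
  also have "\<dots> = (\<Sum>js\<in>?I. if sum_list js + (last (0 # as) + e) \<le> p
      then ?c js * x ^ (p - (last (0 # as) + e) - sum_list js) else 0)"
  proof (rule sum.cong)
    fix js assume "js \<in> ?I"
    show "(if ?d js \<le> e then 0 else ?c js * x ^ ?d js) / x ^ (e + 1) =
      (if sum_list js + (last (0 # as) + e) \<le> p
       then ?c js * x ^ (p - (last (0 # as) + e) - sum_list js) else 0)"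
    proof (cases "sum_list js + (last (0 # as) + e) \<le> p")
      case True
      then have "?d js = (p - (last (0 # as) + e) - sum_list js) + (e + 1)" by linarith
      moreover from this have "\<not> ?d js \<le> e" by linarith
      ultimately show ?thesis
        using True assms by (simp only: power_add if_False if_True) simp
    next
      case False
      then have "?d js \<le> e" by linarith
      with False show ?thesis by (simp only: if_True if_False)
    qed
  qed simp
  also have "\<dots> = (\<Sum>js | js \<in> ?I \<and> sum_list js + (last (0 # as) + e) \<le> p.
      ?c js * x ^ (p - (last (0 # as) + e) - sum_list js))"
    by (subst sum.inter_filter[symmetric]) (auto simp: finite_C_index)
  finally show ?thesis .
qed

text \<open>Faulhaber turns each one-index polynomial of \<open>C_poly_snoc\<close> into a power
  sum; exchanging the sums leaves the truncated quotient at each \<open>m\<close>. This provides all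
  recurrences in \<open>n\<close>.\<close>

lemma poly_C_poly_snoc:
  assumes "b = last (0 # as) + e"
  shows "poly (C_poly p (as @ [b])) (real n) = (\<Sum>m=1..n.
    (poly (C_poly p as) (real m) - (\<Sum>k\<le>e. coeff (C_poly p as) k * real m ^ k)) / real m ^ (e + 1))"
proof -
  let ?A = "{js. js \<in> C_index p (0 # as) \<and> sum_list js + b \<le> p}"
  have "poly (C_poly p (as @ [b])) (real n) =
      (\<Sum>js\<in>?A. \<Sum>m=1..n. C_coeff p (0 # as) js * real m ^ (p - b - sum_list js))"
    using assms by (subst C_poly_snoc) (simp_all add: poly_sum faulhaber sum_distrib_left)
  also have "\<dots> = (\<Sum>m=1..n. \<Sum>js\<in>?A. C_coeff p (0 # as) js * real m ^ (p - b - sum_list js))"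
    by (rule sum.swap)
  also have "\<dots> = (\<Sum>m=1..n.
      (poly (C_poly p as) (real m) - (\<Sum>k\<le>e. coeff (C_poly p as) k * real m ^ k)) / real m ^ (e + 1))"
    unfolding assms by (intro sum.cong poly_minus_low_coeffs_div[symmetric]) auto
  finally show ?thesis .
qed

section \<open>The umbral constant\<close>

lemma umbral_altdef:
  assumes "degree f \<le> d"
  shows "umbral f = (\<Sum>i\<le>d. coeff f i * bern i)"
  unfolding umbral_def using assms
  by (intro sum.mono_neutral_left) (auto simp: coeff_eq_0)

lemma coeff_D_poly: "coeff (D_poly p) i = coeff (C_poly p []) (Suc i)"
  by (simp flip: D_poly_mult)

text \<open>Each inner polynomial of order \<open>p - j\<close> has linear coefficient
  \<open>bern (p - j)\<close>, so the left side is a convolution of Bernoulli numbers. Reversing it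
  gives the umbral value.\<close>

lemma coeff_C_poly_0_1: "coeff (C_poly p [0]) 1 = umbral (D_poly p)"
proof -
  have idx: "{js. js \<in> C_index p [0] \<and> sum_list js \<le> p} = (\<lambda>j. [j]) ` {..p}"
    by (auto simp: C_index_def length_Suc_conv)
  have inj: "inj_on (\<lambda>j. [j]) {..p}"
    by (auto simp: inj_on_def)
  \<comment> \<open>Bounds the degree of \<open>D_poly p\<close>, so that the umbral sum can run up
    to \<open>p\<close>.\<close>
  have "coeff (C_poly p []) i = 0" if "i > Suc p" for i
    unfolding C_poly_Nil coeff_sum using that by (intro sum.neutral) auto
  then have "degree (D_poly p) \<le> p"
    by (intro degree_le) (auto simp: coeff_D_poly)
  then have "umbral (D_poly p) = (\<Sum>i\<le>p. coeff (C_poly p []) (i + 1) * bern i)"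
    by (simp add: umbral_altdef coeff_D_poly)
  also have "\<dots> = (\<Sum>i\<le>p. real ((p + 1) choose (p - i)) * bern (p - i) / real (p + 1) * bern i)"
    by (intro sum.cong refl, subst coeff_C_poly_Nil) auto
  also have "\<dots> = (\<Sum>j\<le>p. real ((p + 1) choose j) * bern j / real (p + 1) * bern (p - j))"
    by (subst sum.nat_diff_reindex[symmetric, of _ "Suc p", unfolded lessThan_Suc_atMost]) simp
  also have "\<dots> = coeff (C_poly p [0]) 1"
  proof -
    have "real p + 1 = real (p + 1)" by simp
    then have "C_coeff p [0] [j] = real ((p + 1) choose j) * bern j / real (p + 1)" for j
      by (simp only: binomial_gbinomial) (simp add: C_coeff_def Let_def add.commute)
    then show ?thesis
      using C_poly_snoc[of "[]" 0 p]
      by (simp add: idx sum.reindex[OF inj] coeff_sum coeff_C_poly_Nil_1[unfolded One_nat_def])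
  qed
  finally show ?thesis ..
qed

section \<open>The identity by induction\<close>

theorem theorem2p9:
  fixes p n :: nat
  assumes "n \<ge> 1"
  shows "(\<Sum>m=1..n. real m ^ p * gen_harm (m - 1) 1 ^ 3) =
      gen_harm n (- int p) * gen_harm n 1 ^ 3
    - 3 * (poly (C_poly p [0]) (real n) + bern p / 2) * gen_harm n 1 ^ 2
    + bern p / 2 * gen_harm n 2
    + (6 * poly (C_poly p [0, 0]) (real n) + 3 * umbral (D_poly p)
       - 3 * poly (C_poly p [1]) (real n)
       - (if p = 0 then 0 else real p / 2 * bern (p - 1))) * gen_harm n 1
    - 6 * poly (C_poly p [0, 0, 0]) (real n)
    + 3 * poly (C_poly p [0, 1]) (real n)
    + 3 * poly (C_poly p [1, 1]) (real n)
    - poly (C_poly p [2]) (real n)"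
proof -
  define \<beta> where "\<beta> = (if p = 0 then 0 else real p / 2 * bern (p - 1))"
  define S where "S n = (\<Sum>m=1..n. real m ^ p)" for n :: nat
  define C0 where "C0 n = poly (C_poly p [0]) (real n)" for n
  define C00 where "C00 n = poly (C_poly p [0, 0]) (real n)" for n
  define C1 where "C1 n = poly (C_poly p [1]) (real n)" for n
  define C000 where "C000 n = poly (C_poly p [0, 0, 0]) (real n)" for n
  define C01 where "C01 n = poly (C_poly p [0, 1]) (real n)" for n
  define C11 where "C11 n = poly (C_poly p [1, 1]) (real n)" for n
  define C2 where "C2 n = poly (C_poly p [2]) (real n)" for n
  note defs = C0_def C00_def C1_def C000_def C01_def C11_def C2_def
  note coeffs = coeff_C_poly_0 coeff_C_poly_Nil_1 coeff_C_poly_Nil_2[of p, folded \<beta>_def] coeff_C_poly_0_1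
  have sum_le_1: "(\<Sum>k\<le>1. f k) = f 0 + f 1" and sum_le_2: "(\<Sum>k\<le>2. f k) = f 0 + f 1 + f 2"
    for f :: "nat \<Rightarrow> real"
    by (simp_all add: numeral_2_eq_2)
  \<comment> \<open>A repeated last entry means \<open>e = 0\<close>: only the vanishing constant
    term is removed.\<close>
  have C0: "C0 n = (\<Sum>m=1..n. S m / real m)" for n
    using poly_C_poly_snoc[of 0 "[]" 0 p n] by (simp add: defs coeffs faulhaber S_def)
  have C00: "C00 n = (\<Sum>m=1..n. C0 m / real m)" for n
    using poly_C_poly_snoc[of 0 "[0]" 0 p n] by (simp add: defs coeffs)
  have C000: "C000 n = (\<Sum>m=1..n. C00 m / real m)" for n
    using poly_C_poly_snoc[of 0 "[0, 0]" 0 p n] by (simp add: defs coeffs)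
  \<comment> \<open>A last entry raised by 1 also removes the linear term, whose coefficient is
    \<open>bern p\<close> here and the umbral constant for \<open>C01\<close>.\<close>
  have C1: "C1 n = (\<Sum>m=1..n. (S m - bern p * real m) / real m ^ 2)" for n
    using poly_C_poly_snoc[of 1 "[]" 1 p n, unfolded sum_le_1 coeffs]
    by (simp add: defs faulhaber S_def numeral_2_eq_2)
  have C01: "C01 n = (\<Sum>m=1..n. (C0 m - umbral (D_poly p) * real m) / real m ^ 2)" for n
    using poly_C_poly_snoc[of 1 "[0]" 1 p n, unfolded sum_le_1 coeffs]
    by (simp add: defs numeral_2_eq_2)
  have C11: "C11 n = (\<Sum>m=1..n. C1 m / real m)" for n
    using poly_C_poly_snoc[of 1 "[1]" 0 p n] by (simp add: defs coeffs)
  \<comment> \<open>A jump by 2 additionally removes the quadratic term, with coefficient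
    \<open>\<beta>\<close>.\<close>
  have C2: "C2 n = (\<Sum>m=1..n. (S m - bern p * real m - \<beta> * real m ^ 2) / real m ^ 3)" for n
    using poly_C_poly_snoc[of 2 "[]" 2 p n, unfolded sum_le_2 coeffs]
    by (simp add: defs faulhaber S_def diff_diff_eq)
  have H1: "gen_harm (Suc n) 1 = gen_harm n 1 + 1 / real (Suc n)" for n
    by (simp add: gen_harm_def power_int_minus field_simps)
  have H2: "gen_harm (Suc n) 2 = gen_harm n 2 + 1 / real (Suc n) ^ 2" for n
    by (simp add: gen_harm_def power_int_minus field_simps)
  have "(\<Sum>m=1..n. real m ^ p * gen_harm (m - 1) 1 ^ 3) =
      S n * gen_harm n 1 ^ 3 - 3 * (C0 n + bern p / 2) * gen_harm n 1 ^ 2 + bern p / 2 * gen_harm n 2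
    + (6 * C00 n + 3 * umbral (D_poly p) - 3 * C1 n - \<beta>) * gen_harm n 1
    - 6 * C000 n + 3 * C01 n + 3 * C11 n - C2 n"
  proof (induction n)
    case 0
    show ?case
      by (simp add: S_def C0 C00 C1 C000 C01 C11 C2 gen_harm_def)
  next
    case (Suc n)
    \<comment> \<open>With \<open>d\<close> and \<open>s\<close> as atoms, every increment is
      polynomial and no division remains. \<open>s\<close> is taken at \<open>Suc n\<close> because
      each recurrence uses the layer below at the new point.\<close>
    define d where "d = 1 / real (Suc n)"
    define s where "s = S (Suc n)"
    have dd: "x / real (Suc n) = x * d" "(x - y * real (Suc n)) / real (Suc n) ^ 2 = x * d ^ 2 - y * d"
      "(x - y * real (Suc n) - z * real (Suc n) ^ 2) / real (Suc n) ^ 3 = x * d ^ 3 - y * d ^ 2 - z * d"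
      for x y z
      by (simp_all add: d_def field_simps power2_eq_square power3_eq_cube del: of_nat_Suc)
    have step: "sum f {1..Suc n} = sum f {1..n} + f (Suc n)" for f :: "nat \<Rightarrow> real"
      by simp
    have st: "S n = s - real (Suc n) ^ p"
        "C0 (Suc n) = C0 n + s * d"
        "C2 (Suc n) = C2 n + (s * d ^ 3 - bern p * d ^ 2 - \<beta> * d)"
        "C1 (Suc n) = C1 n + (s * d ^ 2 - bern p * d)"
      by (simp_all only: s_def S_def C0 C1 C2 step dd add_diff_cancel_right')
    have st': "C00 (Suc n) = C00 n + C0 (Suc n) * d"
        "C01 (Suc n) = C01 n + (C0 (Suc n) * d ^ 2 - umbral (D_poly p) * d)"
        "C11 (Suc n) = C11 n + C1 (Suc n) * d"
      by (simp_all only: C00 C01 C11 step dd)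
    have st'': "C000 (Suc n) = C000 n + C00 (Suc n) * d"
      by (simp only: C000 step dd)
    have H: "gen_harm (Suc n) 1 = gen_harm n 1 + d" "gen_harm (Suc n) 2 = gen_harm n 2 + d ^ 2"
      by (simp_all add: H1 H2 d_def power_divide)
    have "(\<Sum>m=1..Suc n. real m ^ p * gen_harm (m - 1) 1 ^ 3) =
      (\<Sum>m=1..n. real m ^ p * gen_harm (m - 1) 1 ^ 3) + real (Suc n) ^ p * gen_harm n 1 ^ 3"
      by simp
    \<comment> \<open>Now a polynomial identity. The increments of the terms with
      \<open>bern p\<close>, the umbral constant and \<open>\<beta>\<close> cancel the corrections
      carried by \<open>C1\<close>, \<open>C11\<close>, \<open>C01\<close> and \<open>C2\<close>;
      the powers of \<open>d\<close> multiplying \<open>s\<close>, \<open>C0\<close>,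
      \<open>C00\<close> and \<open>C1\<close> cancel by binomial expansion.\<close>
    then show ?case
      unfolding Suc.IH H st'' st' st s_def[symmetric]
      by (simp add: algebra_simps power2_eq_square power3_eq_cube del: of_nat_Suc)
  qed
  then show ?thesis
    by (simp only: defs \<beta>_def S_def gen_harm_neg)
qed

end
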